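(* Let $\mathbb{M}$ be the free groupoid (free magma) on one generator. If $G$ is the minimal generating set of a subgroupoid $N\subseteq \mathbb{M}$, then the sequence $(|N|_n)_{n\geq 1}$ is the Catalan transform of the sequence $(|G|_n)_{n\geq 1}$, i.e. $|N|_n=\mathbf{C}(|G|_n)$.
   Context: A groupoid (magma) is a set with a binary operation, written $+$, with no axioms. $\mathbb{M}$ denotes the free groupoid on a single generator denoted $1$; its elements are $1, 1+1, 1+(1+1), (1+1)+1,\ldots$ (equivalently, finite planar binary trees). A subgroupoid is a subset closed under $+$; the empty set is accepted as a subgroupoid. Each subgroupoid of $\mathbb{M}$ has a unique minimal generating set. The length $\ell:\mathbb{M}\to\mathbb{N}$ is the unique function with $\ell(1)=1$ and $\ell(x+y)=\ell(x)+\ell(y)$. For $X\subseteq \mathbb{M}$, $|X|_n$ is the number of $x\in X$ with $\ell(x)=n$. Given a sequence of integers $(a_n)_{n\geq 1}$, its Catalan transform $\mathbf{C}(a_n)=b_n$ is the sequence $(b_n)_{n\geq 1}$ defined by $b_1=a_1$ and $b_n=a_n+\sum_{i+j=n,\ 0<i,j<n} b_i b_j$. *)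

theory Defs
  imports Complex_Main
begin

text \<open>The free groupoid on one generator, as the algebra of finite planar binary trees;
  \<open>Gen\<close> is the generator written \<open>1\<close> and \<open>\<oplus>\<close> is the groupoid operation written \<open>+\<close>.\<close>

datatype free_groupoid = Gen | Add free_groupoid free_groupoid  (infixl "\<oplus>" 65)

primrec len :: "free_groupoid \<Rightarrow> nat" where
  "len Gen = 1"
| "len (x \<oplus> y) = len x + len y"

definition subgroupoid :: "free_groupoid set \<Rightarrow> bool" where
  "subgroupoid N \<longleftrightarrow> (\<forall>x\<in>N. \<forall>y\<in>N. x \<oplus> y \<in> N)"

definition generates :: "free_groupoid set \<Rightarrow> free_groupoid set \<Rightarrow> bool" where
  "generates G N \<longleftrightarrow> subgroupoid hull G = N"

text \<open>Minimality is with respect to inclusion.\<close>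

definition minimal_generating_set :: "free_groupoid set \<Rightarrow> free_groupoid set \<Rightarrow> bool" where
  "minimal_generating_set G N \<longleftrightarrow>
     generates G N \<and> (\<forall>H. H \<subseteq> G \<and> generates H N \<longrightarrow> H = G)"

definition count_len :: "free_groupoid set \<Rightarrow> nat \<Rightarrow> nat" where
  "count_len X n = card {x \<in> X. len x = n}"

text \<open>Sequences are indexed from 1: the value at index 0 is irrelevant, and no entry with
  positive index depends on it. For \<open>n = 1\<close> the sum is empty, so the first entry is \<open>a 1\<close>.\<close>

function catalan_transform :: "(nat \<Rightarrow> int) \<Rightarrow> nat \<Rightarrow> int" where
  "catalan_transform a n =
     a n + (\<Sum>i\<in>{0<..<n}. catalan_transform a i * catalan_transform a (n - i))"
  by pat_completeness auto
termination
  by (relation "measure snd") auto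

declare catalan_transform.simps [simp del]

lemma len_pos: "len x > 0"
  by (induction x) auto

text \<open>Hence \<open>count_len\<close> is never the cardinality of an infinite set.\<close>

lemma finite_len: "finite {x. len x = n}"
proof (induction n rule: less_induct)
  case (less n)
  let ?P = "\<Union>i\<in>{0<..<n}. case_prod Add ` ({x. len x = i} \<times> {y. len y = n - i})"
  have "x \<in> insert Gen ?P" if "len x = n" for x
  proof (cases x)
    case (Add y z)
    then show ?thesis
      using that len_pos[of y] len_pos[of z] by (auto intro!: bexI[of _ "len y"])
  qed simp
  then have "{x. len x = n} \<subseteq> insert Gen ?P"
    by blast
  moreover have "finite (insert Gen ?P)"
    using less by auto
  ultimately show ?case
    by (rule finite_subset)
qed

end

theory Submission
  imports Defs
begin

text \<open>Every element of \<open>N\<close> is either in \<open>G\<close> or a sum of two elements of \<open>N\<close>; minimality of \<open>G\<close>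
  makes the alternatives exclusive, since the summands of \<open>y \<oplus> z\<close> are shorter than \<open>y \<oplus> z\<close> and
  so are generated without it. Sums decompose uniquely in the free groupoid, so counting by
  length gives the recursion of the Catalan transform.\<close>

lemma subgroupoid_hull: "subgroupoid (subgroupoid hull X)"
  unfolding hull_def subgroupoid_def by blast

text \<open>The set \<open>?S\<close> of generators and sums of hull elements lies inside the hull,
  so a sum of two members of \<open>?S\<close> is again a sum of two hull elements. Thus
  \<open>?S\<close> is closed and, by minimality of the hull, contains it.\<close>

lemma hull_cases:
  assumes "x \<in> subgroupoid hull X"
  shows "x \<in> X \<or> (\<exists>y\<in>subgroupoid hull X. \<exists>z\<in>subgroupoid hull X. x = y \<oplus> z)"
proof -
  let ?S = "X \<union> {y \<oplus> z |y z. y \<in> subgroupoid hull X \<and> z \<in> subgroupoid hull X}"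
  have "?S \<subseteq> subgroupoid hull X"
    using subgroupoid_hull[of X] hull_subset[of X subgroupoid] unfolding subgroupoid_def by blast
  then have "subgroupoid ?S"
    unfolding subgroupoid_def by blast
  then have "subgroupoid hull X \<subseteq> ?S"
    by (intro hull_minimal) auto
  with assms show ?thesis
    by blast
qed

lemma shorter_in_hull_Diff:
  assumes "x \<in> subgroupoid hull X" "len x < len g"
  shows "x \<in> subgroupoid hull (X - {g})"
proof -
  \<comment> \<open>The length guard makes this set closed: if a sum is shorter than
    \<open>g\<close>, so are both summands. It also admits \<open>g\<close> itself vacuously, so
    that all of \<open>X\<close> is contained.\<close>
  let ?S = "{x. len x < len g \<longrightarrow> x \<in> subgroupoid hull (X - {g})}"
  have "subgroupoid ?S"
    using subgroupoid_hull[of "X - {g}"] unfolding subgroupoid_def by auto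
  moreover have "X \<subseteq> ?S"
    using hull_subset[of "X - {g}" subgroupoid] by auto
  ultimately have "subgroupoid hull X \<subseteq> ?S"
    by (intro hull_minimal)
  with assms show ?thesis
    by blast
qed

lemma minimal_generating_set_not_Add:
  assumes "minimal_generating_set G N" "y \<in> N" "z \<in> N"
  shows "y \<oplus> z \<notin> G"
proof
  assume g: "y \<oplus> z \<in> G"
  let ?H = "G - {y \<oplus> z}"
  have N: "N = subgroupoid hull G"
    using assms(1) by (simp add: minimal_generating_set_def generates_def)
  have "y \<in> subgroupoid hull ?H" "z \<in> subgroupoid hull ?H"
    using assms(2,3) len_pos unfolding N by (auto intro!: shorter_in_hull_Diff)
  then have "y \<oplus> z \<in> subgroupoid hull ?H"
    using subgroupoid_hull by (auto simp: subgroupoid_def)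
  then have "G \<subseteq> subgroupoid hull ?H"
    using hull_subset[of ?H subgroupoid] by blast
  then have "N \<subseteq> subgroupoid hull ?H"
    unfolding N by (intro hull_minimal subgroupoid_hull)
  moreover have "subgroupoid hull ?H \<subseteq> N"
    unfolding N by (intro hull_mono) auto
  ultimately have "generates ?H N"
    by (auto simp: generates_def)
  then have "?H = G"
    using assms(1) by (auto simp: minimal_generating_set_def)
  with g show False
    by blast
qed

lemma count_len_minimal_generating_set:
  assumes "minimal_generating_set G N"
  shows "count_len N n = count_len G n + (\<Sum>i\<in>{0<..<n}. count_len N i * count_len N (n - i))"
proof -
  let ?L = "\<lambda>X i. {x \<in> X. len x = i}"
  let ?S = "\<lambda>i. case_prod Add ` (?L N i \<times> ?L N (n - i))"
  have N: "N = subgroupoid hull G"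
    using assms by (simp add: minimal_generating_set_def generates_def)
  have sub: "subgroupoid N" and "G \<subseteq> N"
    unfolding N by (simp_all add: subgroupoid_hull hull_subset)
  have fin: "finite (?L X i)" for X i
    by (rule finite_subset[OF _ finite_len[of i]]) auto
  have "?L N n = ?L G n \<union> (\<Union>i\<in>{0<..<n}. ?S i)"
  proof (intro equalityI subsetI)
    fix x assume x: "x \<in> ?L N n"
    then consider "x \<in> G" | y z where "y \<in> N" "z \<in> N" "x = y \<oplus> z"
      using hull_cases[of x G] unfolding N by blast
    then show "x \<in> ?L G n \<union> (\<Union>i\<in>{0<..<n}. ?S i)"
    proof cases
      case 1
      with x show ?thesis by simp
    next
      case 2
      \<comment> \<open>The index is the length of the left summand; it is strictly between 0 and
        \<open>n\<close> because both summands have positive length.\<close>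
      with x have "len y \<in> {0<..<n}" "x \<in> ?S (len y)"
        using len_pos[of y] len_pos[of z] by auto
      then show ?thesis by blast
    qed
  next
    fix x assume "x \<in> ?L G n \<union> (\<Union>i\<in>{0<..<n}. ?S i)"
    then show "x \<in> ?L N n"
      using sub \<open>G \<subseteq> N\<close> by (auto simp: subgroupoid_def)
  qed
  moreover have "?L G n \<inter> (\<Union>i\<in>{0<..<n}. ?S i) = {}"
    using minimal_generating_set_not_Add[OF assms] by auto
  \<comment> \<open>A sum determines its left summand, hence the index \<open>i\<close>, so the sets
    \<open>?S i\<close> are pairwise disjoint.\<close>
  moreover have "card (\<Union>i\<in>{0<..<n}. ?S i) = (\<Sum>i\<in>{0<..<n}. card (?S i))"
    by (rule card_UN_disjoint) (auto intro: fin)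
  moreover have "card (?S i) = count_len N i * count_len N (n - i)" for i
    by (subst card_image) (auto simp: inj_on_def card_cartesian_product count_len_def)
  ultimately show ?thesis
    by (simp add: count_len_def card_Un_disjoint fin)
qed

theorem theorem5p2:
  fixes N G :: "free_groupoid set"
  assumes "subgroupoid N"
    and "minimal_generating_set G N"
  shows "\<forall>n\<ge>1. int (count_len N n) = catalan_transform (\<lambda>k. int (count_len G k)) n"
proof -
  \<comment> \<open>The recursion holds at 0 as well, with an empty sum, so the induction can run
    over all \<open>n\<close>.\<close>
  have "int (count_len N n) = catalan_transform (\<lambda>k. int (count_len G k)) n" for n
  proof (induction n rule: less_induct)
    case (less n)
    have "int (count_len N n) =
        int (count_len G n) + (\<Sum>i\<in>{0<..<n}. int (count_len N i) * int (count_len N (n - i)))"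
      by (subst count_len_minimal_generating_set[OF assms(2)]) simp
    also have "\<dots> = catalan_transform (\<lambda>k. int (count_len G k)) n"
      \<comment> \<open>After one unfolding, the induction hypothesis applies to both
        \<open>i\<close> and \<open>n - i\<close>, as \<open>0 < i < n\<close>.\<close>
      by (subst catalan_transform.simps) (simp add: less)
    finally show ?case .
  qed
  then show ?thesis
    by blast
qed

end
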